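(* Let $n\ge 3$, $1\le t<n$, and let $c_1,c_2,\ldots,c_t\in[n]$ be distinct integers such that the sequence $(c_1,\ldots,c_t)$ avoids both patterns $123$ and $213$. If there exist $\alpha\in[n]\setminus\{c_1,\ldots,c_t\}$ and $1\le i<j\le t$ with $c_i<\alpha$ and $c_j<\alpha$, then $|S_{n,(c_1,\ldots,c_t)}(123,213)|=0$; otherwise, $$|S_{n,(c_1,\ldots,c_t)}(123,213)|=2^{\max\{0,\min\{c_1,\ldots,c_t\}-2\}}.$$
   Context: $[n]=\{1,\ldots,n\}$ and $S_n$ is the set of permutations of $[n]$ written as sequences $(\tau(1),\ldots,\tau(n))$. A sequence of distinct integers $\tau=(\tau(1),\ldots,\tau(m))$ contains $\sigma\in S_k$ as a pattern if there are indices $1\le i_1<\cdots<i_k\le m$ such that for all $1\le a<b\le k$, $\tau(i_a)<\tau(i_b)$ if and only if $\sigma(a)<\sigma(b)$; otherwise $\tau$ avoids $\sigma$. $S_{n,(c_1,\ldots,c_t)}(\sigma_1,\ldots,\sigma_m)$ is the set of $\tau\in S_n$ with $(\tau(1),\ldots,\tau(t))=(c_1,\ldots,c_t)$ that avoid all of $\sigma_1,\ldots,\sigma_m$. *)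

theory Defs
  imports "HOL-Combinatorics.Multiset_Permutations"
begin

text \<open>
  Sequences are lists, so positions run from 0 rather than from 1; the entries of
  permutations of \<open>{1..n}\<close> and of patterns are still 1-based.
  In \<open>contains\<close>, \<open>f\<close> is the increasing choice of positions of an occurrence.
\<close>

definition contains :: "'a::linorder list \<Rightarrow> nat list \<Rightarrow> bool" where
  "contains \<tau> \<sigma> \<longleftrightarrow>
     (\<exists>f. strict_mono_on {..<length \<sigma>} f \<and> f ` {..<length \<sigma>} \<subseteq> {..<length \<tau>} \<and>
        (\<forall>a b. a < b \<and> b < length \<sigma> \<longrightarrow> (\<tau> ! f a < \<tau> ! f b \<longleftrightarrow> \<sigma> ! a < \<sigma> ! b)))"

definition avoids :: "'a::linorder list \<Rightarrow> nat list \<Rightarrow> bool" where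
  "avoids \<tau> \<sigma> \<longleftrightarrow> \<not> contains \<tau> \<sigma>"

definition prefix_avoiders :: "nat \<Rightarrow> nat list \<Rightarrow> nat list set \<Rightarrow> nat list set" where
  "prefix_avoiders n c \<Sigma> =
     {\<tau> \<in> permutations_of_set {1..n}. take (length c) \<tau> = c \<and> (\<forall>\<sigma>\<in>\<Sigma>. avoids \<tau> \<sigma>)}"

end

theory Submission
  imports Defs
begin

text \<open>
  For sequences of distinct entries, avoiding 123 and 213 together means that every entry is
  preceded by at most one smaller entry. Hence the maximum of such a sequence stands in the first
  or the second place, and it can be removed and inserted there freely; this gives \<open>2 ^ (k - 1)\<close>
  sequences on \<open>k \<ge> 1\<close> values. After the prefix \<open>c\<close> with minimum \<open>m\<close>, every remaining value above
  \<open>m\<close> already has a smaller entry before it, so no smaller remaining value may precede it: the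
  values above \<open>m\<close> come first, in decreasing order, and the values below \<open>m\<close> follow in any order
  that avoids both patterns.
\<close>

section \<open>Joint avoidance of 123 and 213 as a condition on triples\<close>

fun at_most_one_smaller_before :: "'a::linorder list \<Rightarrow> bool" where
  "at_most_one_smaller_before [] \<longleftrightarrow> True"
| "at_most_one_smaller_before (x # xs) \<longleftrightarrow>
     sorted_wrt (\<lambda>y z. \<not> (x < z \<and> y < z)) xs \<and> at_most_one_smaller_before xs"

lemma at_most_one_smaller_before_iff_nth:
  "at_most_one_smaller_before xs \<longleftrightarrow>
     (\<forall>i j k. i < j \<and> j < k \<and> k < length xs \<longrightarrow> \<not> (xs ! i < xs ! k \<and> xs ! j < xs ! k))"
proof (induction xs)
  case (Cons x xs)
  show ?case (is "_ \<longleftrightarrow> ?R")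
  proof
    assume "at_most_one_smaller_before (x # xs)"
    then have *: "\<And>j k. j < k \<Longrightarrow> k < length xs \<Longrightarrow> \<not> (x < xs ! k \<and> xs ! j < xs ! k)"
      and **: "\<And>i j k. i < j \<Longrightarrow> j < k \<Longrightarrow> k < length xs \<Longrightarrow> \<not> (xs ! i < xs ! k \<and> xs ! j < xs ! k)"
      using Cons by (auto simp: sorted_wrt_iff_nth_less)
    show ?R
    proof (intro allI impI, elim conjE)
      fix i j k assume "i < j" "j < k" "k < length (x # xs)"
      \<comment> \<open>Both \<open>j\<close> and \<open>k\<close> are positive, so they shift down
        into \<open>xs\<close>. The triple then starts at the head when \<open>i = 0\<close>, and
        otherwise lies wholly in \<open>xs\<close>; these are the two conjuncts of the
        recursion.\<close>
      then obtain j' k' where "j = Suc j'" "k = Suc k'" "j' < k'" "k' < length xs" "i \<le> j'"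
        by (cases j; cases k) auto
      then show "\<not> ((x # xs) ! i < (x # xs) ! k \<and> (x # xs) ! j < (x # xs) ! k)"
        using *[of j' k'] **[of "i - 1" j' k'] by (cases i) auto
    qed
  next
    assume R: ?R
    have "\<not> (x < xs ! k \<and> xs ! j < xs ! k)" if "j < k" "k < length xs" for j k
      using R[rule_format, of 0 "Suc j" "Suc k"] that by simp
    moreover have "\<not> (xs ! i < xs ! k \<and> xs ! j < xs ! k)"
      if "i < j" "j < k" "k < length xs" for i j k
      using R[rule_format, of "Suc i" "Suc j" "Suc k"] that by simp
    ultimately show "at_most_one_smaller_before (x # xs)"
      unfolding at_most_one_smaller_before.simps Cons sorted_wrt_iff_nth_less by blast
  qed
qed simp

text \<open>A triple has three, none, two or one of its entries in \<open>xs\<close>; the four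
  conjuncts treat these cases in this order. With \<open>xs\<close> as the prefix, the third yields
  the condition for a count of zero and the fourth restricts the remainder.\<close>

lemma at_most_one_smaller_before_append:
  "at_most_one_smaller_before (xs @ ys) \<longleftrightarrow>
     at_most_one_smaller_before xs \<and> at_most_one_smaller_before ys \<and>
     (\<forall>z\<in>set ys. sorted_wrt (\<lambda>x y. \<not> (x < z \<and> y < z)) xs) \<and>
     (\<forall>x\<in>set xs. sorted_wrt (\<lambda>y z. \<not> (x < z \<and> y < z)) ys)"
  by (induction xs) (auto simp: sorted_wrt_append)

text \<open>Trades the position function of \<open>contains\<close> for three explicit indices, so
  that patterns of length 3 can be compared with triples of positions.\<close>

lemma contains_length_3_iff:
  "contains xs [p, q, r] \<longleftrightarrow>
     (\<exists>i j k. i < j \<and> j < k \<and> k < length xs \<and> (xs ! i < xs ! j \<longleftrightarrow> p < q) \<and>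
        (xs ! i < xs ! k \<longleftrightarrow> p < r) \<and> (xs ! j < xs ! k \<longleftrightarrow> q < r))"
  (is "_ \<longleftrightarrow> ?R")
proof
  have three: "{..<length [p, q, r]} = {0, 1, 2}" by auto
  {
    assume "contains xs [p, q, r]"
    then obtain f where f: "strict_mono_on {..<length [p, q, r]} f"
        "f ` {..<length [p, q, r]} \<subseteq> {..<length xs}"
        "\<And>a b. a < b \<Longrightarrow> b < length [p, q, r] \<Longrightarrow>
           (xs ! f a < xs ! f b \<longleftrightarrow> [p, q, r] ! a < [p, q, r] ! b)"
      unfolding contains_def by metis
    have "f 0 < f 1" "f 1 < f 2" "f 2 < length xs"
      using f(1,2) unfolding three by (auto simp: strict_mono_on_def)
    then show ?R
      using f(3)[of 0 1] f(3)[of 0 2] f(3)[of 1 2] by (auto simp: numeral_2_eq_2)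
  next
    assume ?R
    then obtain i j k where ijk: "i < j" "j < k" "k < length xs" "xs ! i < xs ! j \<longleftrightarrow> p < q"
        "xs ! i < xs ! k \<longleftrightarrow> p < r" "xs ! j < xs ! k \<longleftrightarrow> q < r"
      by blast
    let ?f = "\<lambda>a. [i, j, k] ! a"
    have f: "strict_mono_on {..<length [p, q, r]} ?f" "?f ` {..<length [p, q, r]} \<subseteq> {..<length xs}"
      unfolding three using ijk by (auto simp: strict_mono_on_def)
    have order: "\<forall>a b. a < b \<and> b < length [p, q, r] \<longrightarrow>
        (xs ! ?f a < xs ! ?f b \<longleftrightarrow> [p, q, r] ! a < [p, q, r] ! b)"
    proof (intro allI impI)
      fix a b :: nat assume "a < b \<and> b < length [p, q, r]"
      then have "a = 0 \<and> b = 1 \<or> a = 0 \<and> b = 2 \<or> a = 1 \<and> b = 2" by auto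
      then show "xs ! ?f a < xs ! ?f b \<longleftrightarrow> [p, q, r] ! a < [p, q, r] ! b"
        using ijk by (elim disjE) auto
    qed
    show "contains xs [p, q, r]"
      unfolding contains_def by (intro exI[of _ ?f] conjI f order)
  }
qed

lemma not_at_most_one_smaller_before_if_contains:
  assumes "contains xs [p, q, r]" and "p < r" and "q < r"
  shows "\<not> at_most_one_smaller_before xs"
proof -
  obtain i j k where "i < j" "j < k" "k < length xs" "xs ! i < xs ! k" "xs ! j < xs ! k"
    using assms unfolding contains_length_3_iff by blast
  then show ?thesis
    unfolding at_most_one_smaller_before_iff_nth by blast
qed

text \<open>A triple whose last entry exceeds the other two is an occurrence of 123 if its first two
  entries ascend and of 213 if they do not. Conversely, both patterns end in their largest
  entry.\<close>

lemma avoids_123_213_iff: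
  "avoids xs [1, 2, 3] \<and> avoids xs [2, 1, 3] \<longleftrightarrow> at_most_one_smaller_before xs"
proof
  assume avoids: "avoids xs [1, 2, 3] \<and> avoids xs [2, 1, 3]"
  show "at_most_one_smaller_before xs"
    unfolding at_most_one_smaller_before_iff_nth
  proof (intro allI impI notI, elim conjE)
    fix i j k
    assume ijk: "i < j" "j < k" "k < length xs" "xs ! i < xs ! k" "xs ! j < xs ! k"
    show False
    proof (cases "xs ! i < xs ! j")
      case True
      then have "contains xs [1, 2, 3]"
        unfolding contains_length_3_iff using ijk
        by (intro exI[of _ i] exI[of _ j] exI[of _ k]) simp
      then show False using avoids unfolding avoids_def by blast
    next
      case False
      then have "contains xs [2, 1, 3]"
        unfolding contains_length_3_iff using ijk
        by (intro exI[of _ i] exI[of _ j] exI[of _ k]) simp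
      then show False using avoids unfolding avoids_def by blast
    qed
  qed
next
  assume "at_most_one_smaller_before xs"
  then show "avoids xs [1, 2, 3] \<and> avoids xs [2, 1, 3]"
    using not_at_most_one_smaller_before_if_contains[of xs 1 2 3]
      not_at_most_one_smaller_before_if_contains[of xs 2 1 3]
    by (auto simp: avoids_def)
qed

section \<open>Counting the avoiders on a finite set\<close>

lemma sorted_wrt_if_all_right:
  "(\<And>z. z \<in> set xs \<Longrightarrow> P z) \<Longrightarrow> sorted_wrt (\<lambda>_. P) xs"
  by (induction xs) auto

lemma at_most_one_smaller_before_Cons_upper_bound:
  assumes "\<forall>x\<in>set xs. x \<le> b"
  shows "at_most_one_smaller_before (b # xs) \<longleftrightarrow> at_most_one_smaller_before xs"
proof -
  have "sorted_wrt (\<lambda>y z. \<not> (b < z \<and> y < z)) xs"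
    by (rule sorted_wrt_mono_rel[OF _ sorted_wrt_if_all_right[where P = "\<lambda>z. z \<le> b"]])
      (use assms in auto)
  then show ?thesis by simp
qed

text \<open>In second place \<open>b\<close> has only one entry before it, and it is smaller than no
  entry after it, so no forbidden triple involves it.\<close>

lemma at_most_one_smaller_before_insert_upper_bound:
  assumes "\<forall>x\<in>set xs. x \<le> b"
  shows "at_most_one_smaller_before (a # b # xs) \<longleftrightarrow> at_most_one_smaller_before (a # xs)"
  using assms at_most_one_smaller_before_Cons_upper_bound[OF assms] by (auto simp: not_less)

definition avoiders :: "'a::linorder set \<Rightarrow> 'a list set" where
  "avoiders A = {xs \<in> permutations_of_set A. at_most_one_smaller_before xs}"

lemma avoiders_empty [simp]: "avoiders {} = {[]}"
  by (auto simp: avoiders_def)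

text \<open>The two images are the insertions of the new maximum in first and in second place. Since
  \<open>A\<close> is nonempty, \<open>hd\<close> and \<open>tl\<close> are applied only to nonempty
  lists.\<close>

lemma avoiders_insert_upper_bound:
  assumes "A \<noteq> {}" and b: "\<And>a. a \<in> A \<Longrightarrow> a < b"
  shows "avoiders (insert b A) = (#) b ` avoiders A \<union> (\<lambda>xs. hd xs # b # tl xs) ` avoiders A"
    (is "?L = ?R")
proof (intro equalityI subsetI)
  fix ys assume "ys \<in> ?L"
  then have ys: "set ys = insert b A" "distinct ys" "at_most_one_smaller_before ys"
    by (auto simp: avoiders_def permutations_of_set_def)
  have "b \<notin> A" using b by auto
  obtain y ys' where y: "ys = y # ys'" using ys(1) by (cases ys) auto
  show "ys \<in> ?R"
  proof (cases "y = b")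
    case True
    then have "ys' \<in> avoiders A"
      using ys \<open>b \<notin> A\<close> unfolding y avoiders_def permutations_of_set_def by auto
    then show ?thesis using True y by blast
  next
    case False
    then have "y \<in> A" "b \<in> set ys'" using ys y by auto
    then obtain z zs where z: "ys' = z # zs" by (cases ys') auto
    \<comment> \<open>Otherwise \<open>y\<close> and \<open>z\<close> both precede \<open>b\<close>
      and are smaller than it.\<close>
    have "z = b"
    proof (rule ccontr)
      assume "z \<noteq> b"
      then have "b \<in> set zs" "z \<in> A" using \<open>b \<in> set ys'\<close> ys z y by auto
      then show False using ys(3) b[of y] b[of z] \<open>y \<in> A\<close> unfolding y z by auto
    qed
    have "y # zs \<in> avoiders A"
      using ys \<open>b \<notin> A\<close> False unfolding y z \<open>z = b\<close> avoiders_def permutations_of_set_def by auto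
    then show ?thesis unfolding y z \<open>z = b\<close> by force
  qed
next
  fix ys assume "ys \<in> ?R"
  then obtain xs where xs: "xs \<in> avoiders A" and ys: "ys = b # xs \<or> ys = hd xs # b # tl xs"
    by auto
  have A: "set xs = A" "distinct xs" "at_most_one_smaller_before xs"
    using xs by (auto simp: avoiders_def permutations_of_set_def)
  obtain x xs' where x: "xs = x # xs'" using A(1) \<open>A \<noteq> {}\<close> by (cases xs) auto
  have "b \<notin> A" using b by auto
  have le: "\<forall>x\<in>set xs. x \<le> b" using b A by (auto intro: less_imp_le)
  have "at_most_one_smaller_before ys"
    using ys
  proof
    assume "ys = b # xs"
    then show ?thesis using A(3) at_most_one_smaller_before_Cons_upper_bound[OF le] by simp
  next
    assume "ys = hd xs # b # tl xs"
    then show ?thesis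
      using A(3) le at_most_one_smaller_before_insert_upper_bound[of xs' b x] unfolding x by simp
  qed
  then show "ys \<in> ?L"
    using A ys \<open>b \<notin> A\<close> unfolding x avoiders_def permutations_of_set_def by auto
qed

text \<open>Each new maximum after the first element doubles the count, since the two kinds of
  insertion are injective and differ in whether the head is \<open>b\<close>. Truncated subtraction
  gives the empty set its single avoider \<open>[]\<close>.\<close>

lemma card_avoiders:
  assumes "finite A"
  shows "card (avoiders A) = 2 ^ (card A - 1)"
  using assms
proof (induction rule: finite_linorder_max_induct)
  case empty
  then show ?case by simp
next
  case (insert b A)
  show ?case
  proof (cases "A = {}")
    case True
    have "avoiders {b} = {[b]}" by (auto simp: avoiders_def)
    then show ?thesis using True by simp
  next
    case False
    have "b \<notin> A" using insert by auto
    have fin: "finite (avoiders A)" by (simp add: avoiders_def)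
    have ne: "xs \<noteq> []" "hd xs \<noteq> b" if "xs \<in> avoiders A" for xs
      using that False \<open>b \<notin> A\<close>
      by (cases xs; auto simp: avoiders_def permutations_of_set_def)+
    have "inj_on (\<lambda>xs. hd xs # b # tl xs) (avoiders A)"
      by (intro inj_onI) (metis ne(1) list.expand list.inject)
    moreover have "(#) b ` avoiders A \<inter> (\<lambda>xs. hd xs # b # tl xs) ` avoiders A = {}"
      using ne by auto
    ultimately have "card (avoiders (insert b A)) = 2 * card (avoiders A)"
      using fin insert False
      by (simp add: avoiders_insert_upper_bound card_Un_disjoint card_image)
    moreover have "card A > 0" using False insert by (simp add: card_gt_0_iff)
    ultimately show ?thesis
      using insert \<open>b \<notin> A\<close> by (cases "card A") auto
  qed
qed

section \<open>Shape of the entries after the prefix\<close>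

text \<open>The relation forbids a smaller entry before any entry above \<open>m\<close>. Entries at
  most \<open>m\<close> therefore cannot precede those above \<open>m\<close>, and the latter
  decrease weakly.\<close>

lemma sorted_wrt_large_decreasing_iff:
  fixes ys :: "'a::linorder list"
  shows "sorted_wrt (\<lambda>y z. \<not> (m < z \<and> y < z)) ys \<longleftrightarrow>
    (\<exists>ds zs. ys = ds @ zs \<and> sorted_wrt (\<ge>) ds \<and> (\<forall>d\<in>set ds. m < d) \<and> (\<forall>z\<in>set zs. z \<le> m))"
    (is "?L ys \<longleftrightarrow> ?R ys")
proof
  show "?L ys \<Longrightarrow> ?R ys"
  proof (induction ys)
    case (Cons y ys)
    then obtain ds zs where dz: "ys = ds @ zs" "sorted_wrt (\<ge>) ds" "\<forall>d\<in>set ds. m < d"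
        "\<forall>z\<in>set zs. z \<le> m"
      by auto
    show ?case
    proof (cases "m < y")
      case True
      have "d \<le> y" if "d \<in> set ds" for d
      proof -
        have "\<not> (m < d \<and> y < d)" using Cons.prems dz(1) that by simp
        then show ?thesis using dz(3) that by (simp add: not_less)
      qed
      then show ?thesis using True dz by (intro exI[of _ "y # ds"] exI[of _ zs]) auto
    next
      case False
      \<comment> \<open>A head \<open>d\<close> of \<open>ds\<close> would be above
        \<open>m\<close>, with the smaller entry \<open>y\<close> in front of it.\<close>
      have "ds = []"
      proof (cases ds)
        case (Cons d ds')
        then have "m < d" "\<not> (m < d \<and> y < d)" using Cons.prems dz by auto
        with False show ?thesis by auto
      qed simp
      then show ?thesis using False dz by (intro exI[of _ "[]"] exI[of _ "y # zs"]) auto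
    qed
  qed simp
next
  assume "?R ys"
  then obtain ds zs where dz: "ys = ds @ zs" "sorted_wrt (\<ge>) ds" "\<forall>d\<in>set ds. m < d"
      "\<forall>z\<in>set zs. z \<le> m"
    by auto
  have "sorted_wrt (\<lambda>y z. \<not> (m < z \<and> y < z)) ds"
    by (rule sorted_wrt_mono_rel[OF _ dz(2)]) auto
  moreover have "sorted_wrt (\<lambda>y z. \<not> (m < z \<and> y < z)) zs"
    by (rule sorted_wrt_mono_rel[OF _ sorted_wrt_if_all_right[where P = "\<lambda>z. z \<le> m"]])
      (use dz in auto)
  ultimately show "?L ys"
    using dz by (auto simp: sorted_wrt_append)
qed

text \<open>Each entry of \<open>ds\<close> bounds everything after it, so the entries can be peeled
  off one at a time from the front.\<close>

lemma at_most_one_smaller_before_decreasing_append: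
  assumes "sorted_wrt (\<ge>) ds" and "\<forall>d\<in>set ds. \<forall>z\<in>set zs. z \<le> d"
  shows "at_most_one_smaller_before (ds @ zs) \<longleftrightarrow> at_most_one_smaller_before zs"
  using assms
proof (induction ds)
  case (Cons d ds)
  then show ?case
    using at_most_one_smaller_before_Cons_upper_bound[of "ds @ zs" d] by auto
qed simp

lemma decreasing_distinct_unique:
  assumes "sorted_wrt (\<ge>) ds" and "distinct (ds :: 'a::linorder list)"
  shows "ds = rev (sorted_list_of_set (set ds))"
  using assms sorted_list_of_set.idem_if_sorted_distinct[of "rev ds"]
  by (simp add: sorted_wrt_rev)

text \<open>As \<open>m\<close> is not in \<open>B\<close>, every value lies strictly above or
  strictly below it. The values above form a forced decreasing block and only the arrangement of
  those below is free, so counting reduces to \<open>card_avoiders\<close>.\<close>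

lemma permutations_of_set_large_decreasing:
  fixes m :: "'a::linorder"
  assumes "finite B" and "m \<notin> B"
  shows "{ys \<in> permutations_of_set B. at_most_one_smaller_before ys \<and>
            sorted_wrt (\<lambda>y z. \<not> (m < z \<and> y < z)) ys} =
         (@) (rev (sorted_list_of_set {x \<in> B. m < x})) ` avoiders {x \<in> B. x < m}"
    (is "?L = (@) ?D ` _")
proof (intro equalityI subsetI)
  fix ys assume "ys \<in> ?L"
  then have ys: "set ys = B" "distinct ys" "at_most_one_smaller_before ys"
    "sorted_wrt (\<lambda>y z. \<not> (m < z \<and> y < z)) ys"
    by (auto simp: permutations_of_set_def)
  then obtain ds zs where dz: "ys = ds @ zs" "sorted_wrt (\<ge>) ds" "\<forall>d\<in>set ds. m < d"
      "\<forall>z\<in>set zs. z \<le> m"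
    unfolding sorted_wrt_large_decreasing_iff by blast
  have B: "B = set ds \<union> set zs"
    using ys(1) dz(1) by simp
  have less: "\<forall>z\<in>set zs. z < m"
    using dz(4) B \<open>m \<notin> B\<close> by (metis UnCI order_le_less)
  have ds: "set ds = {x \<in> B. m < x}" and zs: "set zs = {x \<in> B. x < m}"
    unfolding B using dz(3) less by (blast dest: less_asym)+
  have "ds = ?D"
    using decreasing_distinct_unique[OF dz(2)] ys(2) dz(1) ds by simp
  moreover have "zs \<in> avoiders {x \<in> B. x < m}"
    using ys(2,3) zs unfolding dz(1) avoiders_def permutations_of_set_def
    by (simp add: at_most_one_smaller_before_append)
  ultimately show "ys \<in> (@) ?D ` avoiders {x \<in> B. x < m}"
    using dz(1) by blast
next
  fix ys assume "ys \<in> (@) ?D ` avoiders {x \<in> B. x < m}"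
  then obtain zs where zs: "ys = ?D @ zs" "set zs = {x \<in> B. x < m}" "distinct zs"
      "at_most_one_smaller_before zs"
    by (auto simp: avoiders_def permutations_of_set_def)
  have D: "set ?D = {x \<in> B. m < x}" "distinct ?D" "sorted_wrt (\<ge>) ?D"
    using \<open>finite B\<close> by (auto simp: sorted_wrt_rev)
  have "m < x \<or> x < m" if "x \<in> B" for x
    using that \<open>m \<notin> B\<close> by (metis linorder_neqE)
  then have "{x \<in> B. m < x} \<union> {x \<in> B. x < m} = B"
    by blast
  then have "set ys = B"
    using zs(1,2) D(1) by (simp del: set_rev)
  moreover have "distinct ys"
    unfolding zs(1) using zs(2,3) D(1,2) by (auto simp del: set_rev distinct_rev)
  moreover have "sorted_wrt (\<lambda>y z. \<not> (m < z \<and> y < z)) ys"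
    unfolding sorted_wrt_large_decreasing_iff
    by (intro exI[of _ ?D] exI[of _ zs] conjI zs(1) D(3)) (unfold D(1) zs(2), auto)
  moreover have "at_most_one_smaller_before ys"
  proof -
    have "\<forall>d\<in>set ?D. \<forall>z\<in>set zs. z \<le> d"
      unfolding D(1) zs(2) by auto
    then show ?thesis
      unfolding zs(1) using at_most_one_smaller_before_decreasing_append[OF D(3)] zs(4) by blast
  qed
  ultimately show "ys \<in> ?L"
    by (auto simp: permutations_of_set_def)
qed

section \<open>Permutations with a prescribed prefix\<close>

lemma prefix_avoiders_123_213:
  assumes "set c \<subseteq> {1..n}" and "distinct c" and "c \<noteq> []"
    and c: "at_most_one_smaller_before c"
  shows "prefix_avoiders n c {[1, 2, 3], [2, 1, 3]} =
    (if \<forall>\<alpha>\<in>{1..n} - set c. sorted_wrt (\<lambda>x y. \<not> (x < \<alpha> \<and> y < \<alpha>)) c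
     then (@) c ` {ys \<in> permutations_of_set ({1..n} - set c). at_most_one_smaller_before ys \<and>
            sorted_wrt (\<lambda>y z. \<not> (Min (set c) < z \<and> y < z)) ys}
     else {})"
proof -
  \<comment> \<open>The minimum gives the strongest of these constraints: \<open>x < z\<close> for
    any \<open>x\<close> in \<open>c\<close> implies \<open>Min (set c) < z\<close>.\<close>
  have Min: "(\<forall>x\<in>set c. sorted_wrt (\<lambda>y z. \<not> (x < z \<and> y < z)) ys) \<longleftrightarrow>
      sorted_wrt (\<lambda>y z. \<not> (Min (set c) < z \<and> y < z)) ys" for ys
  proof
    assume *: "sorted_wrt (\<lambda>y z. \<not> (Min (set c) < z \<and> y < z)) ys"
    show "\<forall>x\<in>set c. sorted_wrt (\<lambda>y z. \<not> (x < z \<and> y < z)) ys"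
      by (intro ballI sorted_wrt_mono_rel[OF _ *]) (meson List.finite_set Min_le le_less_trans)
  qed (use \<open>c \<noteq> []\<close> in simp)
  have "prefix_avoiders n c {[1, 2, 3], [2, 1, 3]} =
      {\<tau> \<in> permutations_of_set {1..n}. take (length c) \<tau> = c \<and> at_most_one_smaller_before \<tau>}"
    unfolding prefix_avoiders_def avoids_123_213_iff[symmetric] by simp
  also have "\<dots> = (@) c ` {ys \<in> permutations_of_set ({1..n} - set c).
      at_most_one_smaller_before (c @ ys)}" (is "?L = ?R")
  proof (intro equalityI subsetI)
    fix \<tau> assume \<tau>: "\<tau> \<in> ?L"
    then obtain ys where ys: "\<tau> = c @ ys"
      by (metis (mono_tags, lifting) append_take_drop_id mem_Collect_eq)
    then have "set c \<union> set ys = {1..n}" "distinct (c @ ys)" "at_most_one_smaller_before (c @ ys)"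
      using \<tau> by (auto simp: permutations_of_set_def)
    then show "\<tau> \<in> ?R"
      using ys by (auto simp: permutations_of_set_def)
  next
    fix \<tau> assume "\<tau> \<in> ?R"
    then show "\<tau> \<in> ?L"
      using assms by (auto simp: permutations_of_set_def)
  qed
  \<comment> \<open>The entries of \<open>ys\<close> are exactly the values missing from
    \<open>c\<close>, so the condition on two prefix entries and one later value does not depend on
    \<open>ys\<close>. It can leave the set comprehension and become the \<open>if\<close>.\<close>
  also have "\<dots> = (@) c ` {ys \<in> permutations_of_set ({1..n} - set c).
      (\<forall>\<alpha>\<in>{1..n} - set c. sorted_wrt (\<lambda>x y. \<not> (x < \<alpha> \<and> y < \<alpha>)) c) \<and>
      at_most_one_smaller_before ys \<and>
      sorted_wrt (\<lambda>y z. \<not> (Min (set c) < z \<and> y < z)) ys}"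
    unfolding at_most_one_smaller_before_append Min using c
    by (intro arg_cong[where f = "(`) ((@) c)"] Collect_cong)
      (auto simp: permutations_of_set_def)
  finally show ?thesis by simp
qed

theorem theorem5p5:
  fixes n t :: nat and c :: "nat list"
  assumes "n \<ge> 3" and "1 \<le> t" and "t < n"
    and "length c = t" and "set c \<subseteq> {1..n}" and "distinct c"
    and "avoids c [1, 2, 3]" and "avoids c [2, 1, 3]"
  shows "card (prefix_avoiders n c {[1, 2, 3], [2, 1, 3]}) =
    (if \<exists>\<alpha> \<in> {1..n} - set c. \<exists>i j. i < j \<and> j < t \<and> c ! i < \<alpha> \<and> c ! j < \<alpha>
     then 0
     else 2 ^ nat (max 0 (int (Min (set c)) - 2)))"
proof -
  let ?m = "Min (set c)"
  let ?B = "{1..n} - set c"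
  have "c \<noteq> []" using assms by auto
  then have m: "?m \<in> set c" and le: "\<And>x. x \<in> set c \<Longrightarrow> ?m \<le> x" by auto
  have c: "at_most_one_smaller_before c"
    using avoids_123_213_iff[of c] assms by blast
  have cond: "(\<forall>\<alpha>\<in>?B. sorted_wrt (\<lambda>x y. \<not> (x < \<alpha> \<and> y < \<alpha>)) c) \<longleftrightarrow>
      \<not> (\<exists>\<alpha>\<in>?B. \<exists>i j. i < j \<and> j < t \<and> c ! i < \<alpha> \<and> c ! j < \<alpha>)"
    unfolding sorted_wrt_iff_nth_less using \<open>length c = t\<close> by blast
  \<comment> \<open>Values below the minimum never occur in \<open>c\<close>, and they are at most
    \<open>n\<close> because the minimum is.\<close>
  have "{x \<in> ?B. x < ?m} = {1..<?m}"
  proof -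
    have "?m \<le> n" using m assms by auto
    then show ?thesis using le by (auto simp: not_less[symmetric])
  qed
  then have large_decreasing: "{ys \<in> permutations_of_set ?B. at_most_one_smaller_before ys \<and>
      sorted_wrt (\<lambda>y z. \<not> (?m < z \<and> y < z)) ys} =
      (@) (rev (sorted_list_of_set {x \<in> ?B. ?m < x})) ` avoiders {1..<?m}"
    using permutations_of_set_large_decreasing[of ?B ?m] m by simp
  \<comment> \<open>Both images prepend a fixed list and so preserve cardinality. One subtraction
    counts the values below the minimum, the other comes from \<open>card_avoiders\<close>.\<close>
  have "card ((@) c ` {ys \<in> permutations_of_set ?B. at_most_one_smaller_before ys \<and>
      sorted_wrt (\<lambda>y z. \<not> (?m < z \<and> y < z)) ys}) = 2 ^ (?m - 1 - 1)"
    unfolding large_decreasing by (subst card_image, simp add: inj_on_def)+ (simp add: card_avoiders)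
  \<comment> \<open>Truncated subtraction on naturals plays the role of the maximum with 0, covering
    minimum 1.\<close>
  also have "?m - 1 - 1 = nat (max 0 (int ?m - 2))" by linarith
  finally have card: "card ((@) c ` {ys \<in> permutations_of_set ?B.
      at_most_one_smaller_before ys \<and> sorted_wrt (\<lambda>y z. \<not> (?m < z \<and> y < z)) ys}) =
      2 ^ nat (max 0 (int ?m - 2))" .
  note eq = prefix_avoiders_123_213[OF \<open>set c \<subseteq> {1..n}\<close> \<open>distinct c\<close> \<open>c \<noteq> []\<close> c,
      unfolded cond]
  show ?thesis
  proof (cases "\<exists>\<alpha>\<in>?B. \<exists>i j. i < j \<and> j < t \<and> c ! i < \<alpha> \<and> c ! j < \<alpha>")
    case True
    then show ?thesis
      unfolding eq if_P[OF True] if_not_P[OF not_not[THEN iffD2, OF True]] by (simp only: card.empty)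
  next
    case False
    show ?thesis
      unfolding eq if_P[OF False] if_not_P[OF False] by (rule card)
  qed
qed

end
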